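(* For the complete graph $K_n$ on $n$ sites, with $M_n(n)$ the expected total propagation time and $M_n(1)$ the expected propagation time of one information (starting with each site knowing a different information), $$\lim_{n\to\infty}\frac{M_n(n)}{M_n(1)}=\frac32 .$$
   Context: Rumor propagation process on the complete graph $K_n$ ($n\ge2$) with sites $x_1,\dots,x_n$: $i_x(t)\subset I_n=\{1,\dots,n\}$ denotes the set of informations known by site $x$ at time $t\in\{0,1,2,\dots\}$. At each time $t$ one of the $\binom n2$ edges, say joining $x$ and $y$, is selected uniformly at random, independently of the past, and then $i_x(t+1)=i_y(t+1)=i_x(t)\cup i_y(t)$, while $i_z(t+1)=i_z(t)$ for $z\neq x,y$. The initial configuration is $i_{x_k}(0)=\{k\}$ for $k=1,\dots,n$. For $H\subset I_n$ the propagation time is $\tau_H=\inf\{t: H\subset i_x(t)\text{ for all sites }x\}$. For $k=1,\dots,n$, $M_n(k)=\mathbb{E}[\tau_{\{1,2,\dots,k\}}]$ under this initial configuration. *)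

theory Defs
  imports "HOL-Probability.Probability"
begin

definition complete_edges :: "nat \<Rightarrow> nat set set" where
  "complete_edges n = {e. e \<subseteq> {1..n} \<and> card e = 2}"

(* The selected edges are the coordinates of the product space, hence independent and uniform.
   For n < 2 there are no edges and pmf_of_set is unspecified. *)
definition edge_space :: "nat \<Rightarrow> (nat \<Rightarrow> nat set) measure" where
  "edge_space n = (\<Pi>\<^sub>M t\<in>(UNIV :: nat set). measure_pmf (pmf_of_set (complete_edges n)))"

(* knowledge w t x is the set of informations known by site x at time t when
   w s is the edge selected at time s. *)
primrec knowledge :: "(nat \<Rightarrow> nat set) \<Rightarrow> nat \<Rightarrow> nat \<Rightarrow> nat set" where
  "knowledge w 0 = (\<lambda>x. {x})"
| "knowledge w (Suc t) =
     (\<lambda>x. if x \<in> w t then (\<Union>y\<in>w t. knowledge w t y) else knowledge w t x)"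

(* The infimum is taken in enat, so it is \<infinity> if the propagation never completes. *)
definition propagation_time :: "nat \<Rightarrow> nat set \<Rightarrow> (nat \<Rightarrow> nat set) \<Rightarrow> enat" where
  "propagation_time n H w = Inf {enat t | t. \<forall>x\<in>{1..n}. H \<subseteq> knowledge w t x}"

definition mean_time :: "nat \<Rightarrow> nat \<Rightarrow> ennreal" where
  "mean_time n k = (\<integral>\<^sup>+ w. ennreal_of_enat (propagation_time n {1..k} w) \<partial>edge_space n)"

end

theory Submission
  imports Defs "HOL-Analysis.Harmonic_Numbers" "HOL-Real_Asymp.Real_Asymp"
begin

text \<open>
  Follow, for every information \<open>k\<close>, the set of sites that know it. These sets all react to the
  same sequence of random edges: the set of \<open>k\<close> absorbs the selected edge if it meets it. A set of
  size \<open>j\<close> grows, by one site, exactly when the edge crosses its boundary, which has probability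
  \<open>p j = 2 j (n - j) / (n (n - 1))\<close>. So a single information needs on average
  \<open>(\<Sum>j = 1..<n. 1 / p j) = (n - 1) H\<close> steps, where \<open>H\<close> is the harmonic number of \<open>n - 1\<close>
  (\<open>expected_time_1\<close>). It remains to see that all informations together need \<open>(3/2 + o(1)) n H\<close> steps.

  Lower bound (\<open>expected_time_n_ge\<close>). Until every site has been touched by some edge, about
  \<open>(n/2) H\<close> steps pass, as in the coupon collector problem with two coupons per draw. At that
  moment the information of a site touched last is known by only two sites, and it still needs
  about \<open>(n - 1) H\<close> steps to reach the others. A single potential, which bounds the expected
  remaining time of this scenario from below, turns the argument into an inequality for one step
  (\<open>lower_potential_drift\<close>).

  Upper bound (\<open>expected_time_n_le\<close>). For one information the spreading time is a sum of independent
  geometric variables, the slowest of which (\<open>j = 1\<close> and \<open>j = n - 1\<close>) have parameter \<open>2/n\<close>. For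
  \<open>\<alpha> < 1\<close> an exponential moment with rate \<open>2 \<alpha> / n\<close> is therefore finite, and it is of order
  \<open>exp (2 \<alpha> H)\<close>. By Markov's inequality and a union bound over the \<open>n\<close> informations, the probability
  that the propagation is incomplete at time \<open>t\<close> is at most a constant depending on \<open>\<alpha>\<close> times
  \<open>n exp (2 \<alpha> H - 2 \<alpha> t / n)\<close>, which starts to decay geometrically at
  \<open>t = (1 + 1 / (2 \<alpha>)) n H\<close>. Letting \<open>\<alpha>\<close> tend to \<open>1\<close> gives the factor \<open>3/2\<close>. The union bound
  loses nothing to leading order because the delay that dominates it, a site that stays
  untouched for a long time, is nearly independent for different sites.

  All probabilities are finite averages: \<open>unabsorbed\<close> gives the survival probabilities of a chain by
  recursion on the first step, and \<open>emeasure_run_notin\<close> identifies them with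
  probabilities on the infinite product space of edge sequences.
\<close>

section \<open>Chains driven by independent uniform choices\<close>

locale uniform_chain =
  fixes E :: "'e set" and step :: "'s \<Rightarrow> 'e \<Rightarrow> 's"
  assumes finite_E: "finite E" and E_nonempty: "E \<noteq> {}"
begin

definition avg :: "('e \<Rightarrow> real) \<Rightarrow> real" where
  "avg f = (\<Sum>e\<in>E. f e) / real (card E)"

primrec run :: "'s \<Rightarrow> (nat \<Rightarrow> 'e) \<Rightarrow> nat \<Rightarrow> 's" where
  "run s w 0 = s"
| "run s w (Suc t) = step (run s w t) (w t)"

text \<open>
  The probability that the chain started in \<open>s\<close> is outside \<open>D\<close> at time \<open>t\<close>. The recursion conditions
  on the first choice, so that the state varies and induction on \<open>t\<close> fits potential arguments.
  If \<open>D\<close> is closed under steps, this is the probability that \<open>D\<close> has not been reached by time \<open>t\<close>, and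
  the sum over \<open>t\<close> is the expected absorption time.
\<close>
primrec unabsorbed :: "'s set \<Rightarrow> nat \<Rightarrow> 's \<Rightarrow> real" where
  "unabsorbed D 0 s = (if s \<in> D then 0 else 1)"
| "unabsorbed D (Suc t) s = avg (\<lambda>e. unabsorbed D t (step s e))"

definition closed_under_step :: "'s set \<Rightarrow> bool" where
  "closed_under_step I \<longleftrightarrow> (\<forall>s\<in>I. \<forall>e\<in>E. step s e \<in> I)"

lemma card_E_pos: "real (card E) > 0"
  using finite_E E_nonempty by (simp add: card_gt_0_iff)

lemma avg_const [simp]: "avg (\<lambda>e. a) = a"
  using card_E_pos by (simp add: avg_def)

lemma avg_mono: "(\<And>e. e \<in> E \<Longrightarrow> f e \<le> g e) \<Longrightarrow> avg f \<le> avg g"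
  unfolding avg_def by (intro divide_right_mono sum_mono) auto

lemma avg_add: "avg (\<lambda>e. f e + g e) = avg f + avg g"
  by (simp add: avg_def sum.distrib add_divide_distrib)

lemma avg_cmult: "avg (\<lambda>e. a * f e) = a * avg f"
  by (simp add: avg_def sum_distrib_left)

lemma avg_sum: "avg (\<lambda>e. \<Sum>i\<in>A. f i e) = (\<Sum>i\<in>A. avg (f i))"
  unfolding avg_def by (subst sum.swap) (simp add: sum_divide_distrib)

lemma avg_cong: "(\<And>e. e \<in> E \<Longrightarrow> f e = g e) \<Longrightarrow> avg f = avg g"
  unfolding avg_def by (simp cong: sum.cong)

lemma avg_nonneg: "(\<And>e. e \<in> E \<Longrightarrow> 0 \<le> f e) \<Longrightarrow> 0 \<le> avg f"
  using avg_mono[of "\<lambda>_. 0" f] by simp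

lemma unabsorbed_nonneg: "0 \<le> unabsorbed D t s"
  by (induction t arbitrary: s) (auto intro: avg_nonneg)

lemma unabsorbed_le_1: "unabsorbed D t s \<le> 1"
proof (induction t arbitrary: s)
  case (Suc t)
  then show ?case using avg_mono[of "\<lambda>e. unabsorbed D t (step s e)" "\<lambda>_. 1"] by simp
qed simp

lemma unabsorbed_eq_0:
  assumes "closed_under_step D" "s \<in> D"
  shows "unabsorbed D t s = 0"
  using assms(2)
proof (induction t arbitrary: s)
  case (Suc t)
  then have "avg (\<lambda>e. unabsorbed D t (step s e)) = avg (\<lambda>e. 0)"
    using assms(1) by (intro avg_cong) (auto simp: closed_under_step_def)
  then show ?case by simp
qed simp

text \<open>Union bound: missing an intersection means missing one of the sets.\<close>
lemma unabsorbed_Inter_le: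
  assumes "finite J"
  shows "unabsorbed (\<Inter>j\<in>J. D j) t s \<le> (\<Sum>j\<in>J. unabsorbed (D j) t s)"
proof (induction t arbitrary: s)
  case 0
  show ?case
  proof (cases "s \<in> (\<Inter>j\<in>J. D j)")
    case False
    then obtain j where j: "j \<in> J" "s \<notin> D j" by auto
    have "unabsorbed (D j) 0 s \<le> (\<Sum>j\<in>J. unabsorbed (D j) 0 s)"
      using j assms by (intro member_le_sum) auto
    then show ?thesis using j False by simp
  qed (auto intro: sum_nonneg)
next
  case (Suc t)
  have "unabsorbed (\<Inter>j\<in>J. D j) (Suc t) s \<le> avg (\<lambda>e. \<Sum>j\<in>J. unabsorbed (D j) t (step s e))"
    by (auto intro: avg_mono Suc)
  then show ?case by (simp add: avg_sum)
qed

text \<open>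
  For \<open>r > 0\<close>, Markov's inequality for the supermartingale \<open>r\<^sup>-\<^sup>t f\<close>: its initial value bounds the expectation at
  time \<open>t\<close>, and outside \<open>D\<close> it is at least \<open>r\<^sup>-\<^sup>t\<close>.
\<close>
lemma unabsorbed_le_geometric:
  assumes I: "closed_under_step I" and s: "s \<in> I"
    and ge: "\<And>s. s \<in> I \<Longrightarrow> s \<notin> D \<Longrightarrow> 1 \<le> f s" "\<And>s. s \<in> I \<Longrightarrow> 0 \<le> f s"
    and decay: "\<And>s. s \<in> I \<Longrightarrow> avg (\<lambda>e. f (step s e)) \<le> r * f s"
    and r: "0 \<le> r"
  shows "unabsorbed D t s \<le> r ^ t * f s"
  using s
proof (induction t arbitrary: s)
  case (Suc t)
  have "unabsorbed D (Suc t) s \<le> avg (\<lambda>e. r ^ t * f (step s e))"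
    using Suc I by (auto intro!: avg_mono simp: closed_under_step_def)
  also have "\<dots> = r ^ t * avg (\<lambda>e. f (step s e))" by (rule avg_cmult)
  also have "\<dots> \<le> r ^ t * (r * f s)"
    using decay[OF Suc.prems] r by (intro mult_left_mono) auto
  finally show ?case by (simp add: ac_simps)
qed (use ge in auto)

lemma sum_unabsorbed_Suc:
  "(\<Sum>t<Suc N. unabsorbed D t s)
     = unabsorbed D 0 s + avg (\<lambda>e. \<Sum>t<N. unabsorbed D t (step s e))"
  by (simp only: sum.lessThan_Suc_shift) (simp add: avg_sum)

text \<open>
  Foster's criterion: a nonnegative potential that loses at least one per step on average outside
  \<open>D\<close> bounds the expected absorption time from above.
\<close>
lemma sum_unabsorbed_le:
  assumes I: "closed_under_step I" and s: "s \<in> I" and D: "closed_under_step D"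
    and nonneg: "\<And>s. s \<in> I \<Longrightarrow> 0 \<le> g s"
    and drift: "\<And>s. s \<in> I \<Longrightarrow> s \<notin> D \<Longrightarrow> 1 + avg (\<lambda>e. g (step s e)) \<le> g s"
  shows "(\<Sum>t<N. unabsorbed D t s) \<le> g s"
  using s
proof (induction N arbitrary: s)
  case (Suc N)
  show ?case
  proof (cases "s \<in> D")
    case True
    then show ?thesis using Suc.prems nonneg unabsorbed_eq_0[OF D True] by simp
  next
    case False
    have "avg (\<lambda>e. \<Sum>t<N. unabsorbed D t (step s e)) \<le> avg (\<lambda>e. g (step s e))"
      using Suc I by (intro avg_mono) (auto simp: closed_under_step_def)
    then show ?thesis using drift[OF Suc.prems False] False
      unfolding sum_unabsorbed_Suc by simp
  qed
qed (use nonneg in auto)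

text \<open>
  The converse comparison: a potential that loses at most one per step bounds the expected
  absorption time from below. A potential left over at the horizon \<open>N\<close> is not yet accounted for by
  elapsed time; it is at most \<open>G\<close> and present only if the chain is still unabsorbed, hence the second
  term, which vanishes in the limit if the chain is almost surely absorbed.
\<close>
lemma sum_unabsorbed_ge:
  assumes I: "closed_under_step I" and s: "s \<in> I"
    and le: "\<And>s. s \<in> I \<Longrightarrow> g s \<le> G" "\<And>s. s \<in> I \<Longrightarrow> s \<in> D \<Longrightarrow> g s \<le> 0"
    and drift: "\<And>s. s \<in> I \<Longrightarrow> s \<notin> D \<Longrightarrow> g s \<le> 1 + avg (\<lambda>e. g (step s e))"
    and G: "0 \<le> G"
  shows "g s \<le> (\<Sum>t<N. unabsorbed D t s) + G * unabsorbed D N s"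
  using s
proof (induction N arbitrary: s)
  case (Suc N)
  show ?case
  proof (cases "s \<in> D")
    case True
    then have "g s \<le> 0" using le Suc.prems by auto
    also have "0 \<le> (\<Sum>t<Suc N. unabsorbed D t s) + G * unabsorbed D (Suc N) s"
      by (intro add_nonneg_nonneg sum_nonneg mult_nonneg_nonneg G unabsorbed_nonneg)
    finally show ?thesis .
  next
    case False
    have "avg (\<lambda>e. g (step s e))
        \<le> avg (\<lambda>e. (\<Sum>t<N. unabsorbed D t (step s e)) + G * unabsorbed D N (step s e))"
      using Suc I by (intro avg_mono) (auto simp: closed_under_step_def)
    then show ?thesis using drift[OF Suc.prems False] False
      unfolding sum_unabsorbed_Suc avg_add avg_cmult by simp
  qed
qed (use le in auto)

section \<open>Survival probabilities on the space of choice sequences\<close>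

lemma run_case_nat: "run s (case_nat e w) (Suc t) = run (step s e) w t"
  by (induction t) auto

abbreviation path_space :: "(nat \<Rightarrow> 'e) measure" where
  "path_space \<equiv> \<Pi>\<^sub>M t\<in>(UNIV :: nat set). measure_pmf (pmf_of_set E)"

text \<open>
  The recursion of \<open>unabsorbed\<close> holds on the product space because prepending an independent choice
  to a sequence of independent choices preserves the product measure. Measurability is a genuine
  hypothesis: the choice sequence may leave \<open>E\<close> on a null set, where the set of all choices may be
  uncountable and an arbitrary function of several choices need not be measurable.
\<close>
lemma emeasure_run_notin:
  assumes meas: "\<And>s t. {w. run s w t \<notin> D} \<in> sets path_space"
  shows "emeasure path_space {w. run s w t \<notin> D} = ennreal (unabsorbed D t s)"
proof (induction t arbitrary: s)
  interpret P: prob_space "measure_pmf (pmf_of_set E)" by (rule measure_pmf.prob_space_axioms)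
  interpret sequence_space "measure_pmf (pmf_of_set E)" ..
  {
    case 0
    have "emeasure path_space UNIV = 1" using emeasure_space_1 by (simp add: space_PiM)
    then show ?case by simp
  next
    case (Suc t)
    let ?M = "measure_pmf (pmf_of_set E)" and ?X = "{w. run s w (Suc t) \<notin> D}"
    let ?h = "\<lambda>(e, w). case_nat e w"
    have h: "?h \<in> ?M \<Otimes>\<^sub>M path_space \<rightarrow>\<^sub>M path_space" by measurable
    have hX: "?h -` ?X \<in> sets (?M \<Otimes>\<^sub>M path_space)"
      using measurable_sets[OF h meas, of s "Suc t"]
      by (simp add: space_pair_measure space_PiM del: run.simps)
    have "emeasure path_space ?X = emeasure (distr (?M \<Otimes>\<^sub>M path_space) path_space ?h) ?X"
      by (simp only: PiM_iter)
    also have "\<dots> = emeasure (?M \<Otimes>\<^sub>M path_space) (?h -` ?X)"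
      using emeasure_distr[OF h meas, of s "Suc t"]
      by (simp add: space_pair_measure space_PiM del: run.simps)
    also have "\<dots> = (\<integral>\<^sup>+e. emeasure path_space (Pair e -` (?h -` ?X)) \<partial>?M)"
      by (rule emeasure_pair_measure_alt[OF hX])
    also have "\<dots> = (\<integral>\<^sup>+e. ennreal (unabsorbed D t (step s e)) \<partial>?M)"
    proof (rule nn_integral_cong)
      fix e
      have "Pair e -` (?h -` ?X) = {w. run (step s e) w t \<notin> D}"
        unfolding vimage_def by (simp add: run_case_nat del: run.simps)
      then show "emeasure path_space (Pair e -` (?h -` ?X)) = ennreal (unabsorbed D t (step s e))"
        using Suc by simp
    qed
    also have "\<dots> = (\<Sum>e\<in>E. ennreal (unabsorbed D t (step s e))) / ennreal (real (card E))"
      using finite_E E_nonempty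
      by (simp add: nn_integral_pmf_of_set ennreal_of_nat_eq_real_of_nat)
    also have "\<dots> = ennreal (unabsorbed D (Suc t) s)"
      using card_E_pos unabsorbed_nonneg
      by (simp add: avg_def sum_ennreal divide_ennreal sum_nonneg)
    finally show ?case .
  }
qed

end

section \<open>Spreading sets of informed sites\<close>

text \<open>
  The state assigns to each information the set of sites knowing it, the transpose of the
  assignment of informations to sites. In this form each information evolves on its own, driven by
  the common edges.
\<close>
definition spread :: "(nat \<Rightarrow> nat set) \<Rightarrow> nat set \<Rightarrow> nat \<Rightarrow> nat set" where
  "spread c e k = (if c k \<inter> e = {} then c k else c k \<union> e)"

lemma mem_spread_iff: "x \<in> spread c e k \<longleftrightarrow> x \<in> c k \<or> x \<in> e \<and> (\<exists>y. y \<in> c k \<and> y \<in> e)"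
  by (auto simp: spread_def)

lemma card_complete_edges: "card (complete_edges n) = n choose 2"
  using n_subsets[of "{1..n}" 2] by (simp add: complete_edges_def)

lemma finite_complete_edges: "finite (complete_edges n)"
  unfolding complete_edges_def by (rule finite_subset[of _ "Pow {1..n}"]) auto

locale gossip =
  fixes n :: nat
  assumes n_ge_2: "2 \<le> n"

sublocale gossip \<subseteq> uniform_chain "complete_edges n" spread
proof
  show "complete_edges n \<noteq> {}"
    using n_ge_2 card_complete_edges[of n] zero_less_binomial[of 2 n] by auto
qed (rule finite_complete_edges)

context gossip
begin

definition configs :: "(nat \<Rightarrow> nat set) set" where
  "configs = {c. \<forall>k\<in>{1..n}. k \<in> c k \<and> c k \<subseteq> {1..n}}"

definition known_everywhere :: "nat \<Rightarrow> (nat \<Rightarrow> nat set) set" where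
  "known_everywhere k = {c. {1..n} \<subseteq> c k}"

text \<open>The probability that a set of \<open>j\<close> informed sites grows in one step.\<close>
definition gain_prob :: "nat \<Rightarrow> real" where
  "gain_prob j = 2 * real j * (real n - real j) / (real n * (real n - 1))"

lemma real_card_edges: "real (card (complete_edges n)) = real n * (real n - 1) / 2"
  unfolding card_complete_edges choose_two
  using n_ge_2 by (simp add: real_of_nat_div even_mult_exp_div_exp_iff of_nat_diff)

lemma closed_configs: "closed_under_step configs"
  unfolding closed_under_step_def
proof (intro ballI)
  fix c e assume c: "c \<in> configs" and e: "e \<in> complete_edges n"
  have "k \<in> c k \<and> c k \<subseteq> {1..n}" if "k \<in> {1..n}" for k
    using c that by (simp add: configs_def)
  moreover have "e \<subseteq> {1..n}" using e by (simp add: complete_edges_def)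
  ultimately have "k \<in> spread c e k \<and> spread c e k \<subseteq> {1..n}" if "k \<in> {1..n}" for k
    using that unfolding spread_def by (metis Un_iff Un_least)
  then show "spread c e \<in> configs" by (simp add: configs_def)
qed

lemma closed_complete: "closed_under_step (\<Inter>k\<in>J. known_everywhere k)"
  unfolding closed_under_step_def known_everywhere_def by (auto simp: mem_spread_iff subset_iff)

text \<open>
  An edge that meets \<open>A\<close> without lying inside it has exactly one end on either side.
\<close>
lemma card_crossing_edges:
  assumes A: "A \<subseteq> {1..n}"
  shows "card {e \<in> complete_edges n. A \<inter> e \<noteq> {} \<and> \<not> e \<subseteq> A} = card A * (n - card A)"
proof -
  let ?C = "{e \<in> complete_edges n. A \<inter> e \<noteq> {} \<and> \<not> e \<subseteq> A}"
  have "bij_betw (\<lambda>(a, b). {a, b}) (A \<times> ({1..n} - A)) ?C"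
  proof (intro bij_betw_imageI)
    show "inj_on (\<lambda>(a, b). {a, b}) (A \<times> ({1..n} - A))"
      by (auto simp: inj_on_def doubleton_eq_iff)
    show "(\<lambda>(a, b). {a, b}) ` (A \<times> ({1..n} - A)) = ?C"
    proof (intro equalityI subsetI)
      fix e assume "e \<in> ?C"
      then obtain a b where ab: "a \<in> A" "a \<in> e" "b \<in> e" "b \<notin> A" and e: "e \<subseteq> {1..n}" "card e = 2"
        by (auto simp: complete_edges_def)
      from e(2) obtain x y where "e = {x, y}" by (auto simp: card_2_iff)
      with ab have "e = {a, b}" by auto
      with ab e show "e \<in> (\<lambda>(a, b). {a, b}) ` (A \<times> ({1..n} - A))" by auto
    qed (use A in \<open>auto simp: complete_edges_def card_2_iff\<close>)
  qed
  then have "card ?C = card (A \<times> ({1..n} - A))" by (simp add: bij_betw_same_card)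
  also have "\<dots> = card A * (n - card A)"
    using A by (simp add: card_cartesian_product card_Diff_subset finite_subset)
  finally show ?thesis .
qed

text \<open>
  The number of sites knowing one information is itself a Markov chain: it increases by one when the
  edge crosses the boundary of the informed set and stays put otherwise.
\<close>
lemma avg_card_spread:
  fixes F :: "nat \<Rightarrow> real"
  assumes A: "c k \<subseteq> {1..n}" and j: "card (c k) = j"
  shows "avg (\<lambda>e. F (card (spread c e k))) = F j + gain_prob j * (F (Suc j) - F j)"
proof -
  let ?E = "complete_edges n"
  let ?C = "{e \<in> ?E. c k \<inter> e \<noteq> {} \<and> \<not> e \<subseteq> c k}"
  have fin: "finite (c k)" using A by (rule finite_subset) simp
  have jn: "j \<le> n" using card_mono[OF _ A] j by simp
  have card_spread: "card (spread c e k) = (if e \<in> ?C then Suc j else j)" if e: "e \<in> ?E" for e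
  proof (cases "e \<in> ?C")
    case True
    obtain x y where xy: "e = {x, y}" "x \<noteq> y" using e by (auto simp: complete_edges_def card_2_iff)
    have "\<exists>b. b \<notin> c k \<and> c k \<union> e = insert b (c k)"
      using True xy by auto
    then show ?thesis using True fin j by (auto simp: spread_def)
  next
    case False
    then have "spread c e k = c k" using e by (auto simp: spread_def)
    then show ?thesis using False j by simp
  qed
  have "(\<Sum>e\<in>?E. F (card (spread c e k)))
      = (\<Sum>e\<in>?E. F j + (if e \<in> ?C then F (Suc j) - F j else 0))"
    by (intro sum.cong) (auto simp: card_spread)
  also have "\<dots> = real (card ?E) * F j + real (card ?C) * (F (Suc j) - F j)"
    by (simp add: sum.distrib sum.If_cases[OF finite_complete_edges] Int_def conj_ac)
  also have "real (card ?C) = real j * (real n - real j)"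
    using card_crossing_edges[OF A] j jn by (simp add: of_nat_diff)
  finally have sum: "(\<Sum>e\<in>?E. F (card (spread c e k)))
      = real (card ?E) * F j + real j * (real n - real j) * (F (Suc j) - F j)" .
  show ?thesis
    unfolding avg_def sum using card_E_pos n_ge_2
    by (simp add: add_divide_distrib gain_prob_def real_card_edges)
qed

lemma complete_iff: "c \<in> configs \<Longrightarrow> k \<in> {1..n} \<Longrightarrow> c \<in> known_everywhere k \<longleftrightarrow> card (c k) = n"
proof -
  assume "c \<in> configs" "k \<in> {1..n}"
  then have "c k \<subseteq> {1..n}" by (auto simp: configs_def)
  moreover have "card {1..n} = n" by simp
  ultimately show "c \<in> known_everywhere k \<longleftrightarrow> card (c k) = n"
    unfolding known_everywhere_def mem_Collect_eq
    by (metis card_subset_eq finite_atLeastAtMost subset_antisym order_refl)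
qed

lemma config_card:
  assumes "c \<in> configs" "k \<in> {1..n}"
  shows "1 \<le> card (c k)" "card (c k) \<le> n" "c k \<subseteq> {1..n}" "finite (c k)"
proof -
  show sub: "c k \<subseteq> {1..n}" using assms by (auto simp: configs_def)
  then show fin: "finite (c k)" by (rule finite_subset) simp
  show "card (c k) \<le> n" using card_mono[OF _ sub] by simp
  show "1 \<le> card (c k)" using assms fin by (auto simp: configs_def Suc_le_eq card_gt_0_iff)
qed

section \<open>The propagation time as an absorption time\<close>

definition start :: "nat \<Rightarrow> nat set" where
  "start = (\<lambda>k. {k})"

lemma start_in_configs: "start \<in> configs"
  by (simp add: start_def configs_def)

text \<open>
  The two transposed descriptions agree for all edge sequences, including those that leave the set of
  edges.
\<close>
lemma knowledge_eq: "knowledge w t x = {k. x \<in> run start w t k}"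
proof (induction t arbitrary: x)
  case (Suc t)
  then show ?case by (auto simp: mem_spread_iff)
qed (auto simp: start_def)

lemma run_mono: "t \<le> u \<Longrightarrow> run c w t k \<subseteq> run c w u k"
  by (induction u rule: dec_induct) (auto simp: mem_spread_iff)

text \<open>
  A site learns an information at a step if it shares the edge with some knowing site. Since there
  are countably many sites, this is a countable union of events about single edges, which
  makes the event measurable although the space of edges is an uncountable type.
\<close>
lemma sets_run: "{w. x \<in> run c w t k} \<in> sets path_space"
proof (induction t arbitrary: x)
  case 0
  have "{w. x \<in> run c w 0 k} \<in> {UNIV, {}}" by auto
  moreover have "UNIV \<in> sets path_space"
    using sets.top[of path_space] by (simp add: space_PiM)
  ultimately show ?case by auto
next
  case (Suc t)
  have [measurable]: "Measurable.pred path_space (\<lambda>w. x \<in> run c w t k)" for x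
    using Suc[of x] by (simp add: pred_def space_PiM)
  have [measurable]: "Measurable.pred path_space (\<lambda>w. x \<in> w t)" for x
  proof -
    have "(\<lambda>w. w t) \<in> path_space \<rightarrow>\<^sub>M measure_pmf (pmf_of_set (complete_edges n))"
      by (rule measurable_component_singleton) simp
    then have "(\<lambda>w. w t) -` {e. x \<in> e} \<inter> space path_space \<in> sets path_space"
      by (rule measurable_sets) simp
    then show ?thesis by (simp add: pred_def space_PiM)
  qed
  have "Measurable.pred path_space
      (\<lambda>w. x \<in> run c w t k \<or> (x \<in> w t \<and> (\<exists>y. y \<in> run c w t k \<and> y \<in> w t)))"
    by measurable
  moreover have "x \<in> run c w (Suc t) k
      \<longleftrightarrow> x \<in> run c w t k \<or> (x \<in> w t \<and> (\<exists>y. y \<in> run c w t k \<and> y \<in> w t))" for w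
    by (auto simp: mem_spread_iff)
  ultimately show ?case by (simp only: pred_def space_PiM) (simp add: space_PiM)
qed

lemma sets_run_incomplete:
  assumes "finite J"
  shows "{w. run c w t \<notin> (\<Inter>k\<in>J. known_everywhere k)} \<in> sets path_space"
proof -
  have "{w. run c w t \<notin> (\<Inter>k\<in>J. known_everywhere k)}
      = (\<Union>k\<in>J. \<Union>x\<in>{1..n}. space path_space - {w. x \<in> run c w t k})"
    by (auto simp: known_everywhere_def space_PiM)
  also have "\<dots> \<in> sets path_space"
    using assms sets_run by (intro sets.finite_UN sets.Diff sets.top) auto
  finally show ?thesis .
qed

text \<open>
  Knowledge only grows, so the infimum over completion times exceeds \<open>t\<close> exactly when the propagation
  is incomplete at time \<open>t\<close>.
\<close>
lemma less_propagation_time_iff: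
  "enat t < propagation_time n J w \<longleftrightarrow> run start w t \<notin> (\<Inter>k\<in>J. known_everywhere k)"
proof -
  let ?done = "\<lambda>t. \<forall>x\<in>{1..n}. J \<subseteq> knowledge w t x"
  have iff: "?done t \<longleftrightarrow> run start w t \<in> (\<Inter>k\<in>J. known_everywhere k)" for t
    by (auto simp: knowledge_eq known_everywhere_def)
  have mono: "t \<le> u \<Longrightarrow> ?done t \<Longrightarrow> ?done u" for t u
    using run_mono[of t u start w] by (auto simp: knowledge_eq)
  have "propagation_time n J w \<le> enat t \<longleftrightarrow> ?done t"
  proof
    assume "?done t"
    then show "propagation_time n J w \<le> enat t"
      unfolding propagation_time_def by (intro Inf_lower) auto
  next
    assume le: "propagation_time n J w \<le> enat t"
    show "?done t"
    proof (rule ccontr)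
      assume "\<not> ?done t"
      then have "u > t" if "?done u" for u using mono[of u t] that by force
      then have "enat (Suc t) \<le> propagation_time n J w"
        unfolding propagation_time_def by (intro Inf_greatest) (auto simp: Suc_le_eq)
      with le show False using order_trans by fastforce
    qed
  qed
  then show ?thesis using iff by (simp add: not_le[symmetric])
qed

text \<open>The tail-sum formula for the expectation of a random variable with values in \<open>enat\<close>.\<close>
lemma mean_time_eq_suminf:
  "mean_time n m = (\<Sum>t. ennreal (unabsorbed (\<Inter>k\<in>{1..m}. known_everywhere k) t start))"
proof -
  let ?D = "\<Inter>k\<in>{1..m}. known_everywhere k"
  let ?\<tau> = "propagation_time n {1..m}"
  have lt: "{w \<in> space path_space. enat t < ?\<tau> w} = {w. run start w t \<notin> ?D}" for t
    by (simp add: less_propagation_time_iff space_PiM)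
  have [measurable]: "Measurable.pred path_space (\<lambda>w. enat t < ?\<tau> w)" for t
    unfolding pred_def lt by (rule sets_run_incomplete) simp
  have "?\<tau> \<in> measurable path_space (count_space UNIV)"
  proof (subst measurable_count_space_eq2_countable, safe)
    fix a :: enat
    \<comment> \<open>the event that the propagation time is \<open>a\<close>, in terms of countably many events \<open>enat t < ?\<tau> w\<close>\<close>
    have "Measurable.pred path_space
        (\<lambda>w. (\<forall>s. enat s < a \<longrightarrow> enat s < ?\<tau> w) \<and> (\<forall>t. a = enat t \<longrightarrow> \<not> enat t < ?\<tau> w))"
      by measurable
    moreover have "(\<forall>s. enat s < a \<longrightarrow> enat s < x) \<and> (\<forall>t. a = enat t \<longrightarrow> \<not> enat t < x) \<longleftrightarrow> x = a"
      for x
    proof (cases "x < a")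
      case True
      then have "\<exists>s. x = enat s" by (cases x) auto
      then show ?thesis using True by auto
    next
      case False
      then have "enat s < a \<Longrightarrow> enat s < x" for s by (meson less_le_trans not_less)
      then show ?thesis using False by (cases a) auto
    qed
    ultimately show "?\<tau> -` {a} \<inter> space path_space \<in> sets path_space"
      by (simp add: pred_def vimage_def Int_def conj_commute)
  qed auto
  then have "mean_time n m = (\<Sum>t. emeasure path_space {w. run start w t \<notin> ?D})"
    unfolding mean_time_def edge_space_def
    by (subst nn_integral_enat_function, assumption) (simp only: lt)
  then show ?thesis
    by (simp only: emeasure_run_notin[OF sets_run_incomplete[OF finite_atLeastAtMost]])
qed

end

section \<open>Harmonic numbers\<close>

lemma sum_inverse_squares_le_2: "(\<Sum>i=1..<n. 1 / (real i)\<^sup>2) \<le> 2"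
proof -
  \<comment> \<open>telescoping: \<open>1 / (m + 1)\<^sup>2 \<le> 1 / m - 1 / (m + 1)\<close>\<close>
  have *: "(\<Sum>i=1..<Suc m. 1 / (real i)\<^sup>2) \<le> 2 - 1 / real m" if "1 \<le> m" for m
    using that
  proof (induction m rule: dec_induct)
    case (step m)
    have "(\<Sum>i=1..<Suc (Suc m). 1 / (real i)\<^sup>2) \<le> 2 - 1 / real m + 1 / (real (Suc m))\<^sup>2"
      using step by simp
    moreover have "1 / (real (Suc m))\<^sup>2 \<le> 1 / (real m * real (Suc m))"
      using step by (intro frac_le) (auto simp: power2_eq_square intro!: mult_right_mono)
    moreover have "1 / (real m * real (Suc m)) = 1 / real m - 1 / real (Suc m)"
      using step by (simp add: field_simps)
    ultimately show ?case by linarith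
  qed simp
  show ?thesis
  proof (cases "2 \<le> n")
    case True
    then obtain m where m: "n = Suc m" "1 \<le> m" by (cases n) auto
    have "2 - 1 / real m \<le> 2" by simp
    then show ?thesis unfolding m(1) using *[OF m(2)] by linarith
  next
    case False
    then have "n = 0 \<or> n = 1" by auto
    then show ?thesis by auto
  qed
qed

lemma harm_real_nonneg [simp]: "0 \<le> (harm n :: real)"
  by (rule harm_nonneg)

lemma one_le_one_div_one_minus:
  fixes x :: real
  shows "0 \<le> x \<Longrightarrow> x < 1 \<Longrightarrow> 1 \<le> 1 / (1 - x)"
  by simp

text \<open>
  Removing one element from a set of \<open>u\<close> elements lowers the harmonic number by \<open>1/u\<close>; removing a
  second one costs \<open>1/(u - 1)\<close>, that is, \<open>1/u\<close> and an excess of \<open>1/(u (u - 1))\<close>. Charging \<open>1/u\<close> per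
  element makes the main part linear in the number of removed elements.
\<close>
lemma harm_diff_card_le:
  assumes "finite U" "card e = 2"
  shows "harm (card U) - harm (card (U - e))
    \<le> real (card (U \<inter> e)) / real (card U)
      + (if e \<subseteq> U then 1 / (real (card U) * (real (card U) - 1)) else 0)"
proof -
  let ?u = "card U"
  have fin: "finite e" using assms(2) by (simp add: card_ge_0_finite)
  have d: "card (U - e) = ?u - card (U \<inter> e)" "card (U \<inter> e) \<le> ?u"
    using assms fin by (simp_all add: card_Diff_subset_Int card_mono)
  have "card (U \<inter> e) \<le> 2" using card_mono[OF fin, of "U \<inter> e"] assms by simp
  then consider "card (U \<inter> e) = 0" | "card (U \<inter> e) = 1" | "card (U \<inter> e) = 2" by linarith
  then show ?thesis
  proof cases
    case 1
    then have "\<not> e \<subseteq> U" using assms by (auto simp: Int_absorb1)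
    then show ?thesis using 1 d by simp
  next
    case 2
    then have "\<not> e \<subseteq> U" using assms by (auto simp: Int_absorb1)
    moreover obtain v where "?u = Suc v" using 2 d by (cases ?u) auto
    ultimately show ?thesis using 2 d by (simp add: harm_Suc inverse_eq_divide)
  next
    case 3
    then have "U \<inter> e = e" using assms fin by (intro card_subset_eq) auto
    moreover obtain v where v: "?u = Suc (Suc v)" using 3 d
      by (metis add_2_eq_Suc le_Suc_ex)
    ultimately have "e \<subseteq> U" by auto
    moreover have "1 / (real v + 1) = 1 / (real v + 2) + 1 / ((real v + 2) * (real v + 1))"
      by (simp add: divide_simps)
    moreover have "harm ?u = harm v + 1 / (real v + 1) + 1 / (real v + 2)"
      unfolding v harm_Suc by (simp add: inverse_eq_divide add_ac)
    ultimately show ?thesis using 3 d v by (simp add: add_ac)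
  qed
qed

context gossip
begin

section \<open>Mean spreading time from a given number of informed sites\<close>

text \<open>
  The expected time for an information to reach all sites from \<open>j\<close> of them: a sum of means of
  geometric variables, one for each size passed on the way.
\<close>
definition spread_mean :: "nat \<Rightarrow> real" where
  "spread_mean j = (\<Sum>i\<in>{j..<n}. 1 / gain_prob i)"

lemma gain_prob_pos: "1 \<le> j \<Longrightarrow> j < n \<Longrightarrow> 0 < gain_prob j"
  using n_ge_2 by (simp add: gain_prob_def)

lemma gain_prob_nonneg: "j \<le> n \<Longrightarrow> 0 \<le> gain_prob j"
  using n_ge_2 by (simp add: gain_prob_def)

lemma spread_mean_nonneg: "0 \<le> spread_mean j"
  unfolding spread_mean_def by (intro sum_nonneg) (simp add: gain_prob_nonneg)

lemma spread_mean_le: "i \<le> j \<Longrightarrow> spread_mean j \<le> spread_mean i"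
  unfolding spread_mean_def by (intro sum_mono2) (auto simp: gain_prob_nonneg)

lemma spread_mean_Suc: "j < n \<Longrightarrow> spread_mean j = 1 / gain_prob j + spread_mean (Suc j)"
  unfolding spread_mean_def by (rule sum.atLeast_Suc_lessThan)

text \<open>
  The defining equation of a mean absorption time, which makes \<open>spread_mean\<close> a potential with drift
  exactly \<open>-1\<close>.
\<close>
lemma avg_spread_mean:
  assumes "c \<in> configs" "k \<in> {1..n}" "card (c k) < n"
  shows "1 + avg (\<lambda>e. spread_mean (card (spread c e k))) = spread_mean (card (c k))"
proof -
  note c = config_card[OF assms(1,2)]
  show ?thesis
    using gain_prob_pos[OF c(1) assms(3)]
    by (subst avg_card_spread[of c k, OF c(3) refl]) (simp add: spread_mean_Suc[OF assms(3)])
qed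

lemma sum_reflect: "(\<Sum>i\<in>{1..<n}. f (n - i)) = (\<Sum>i\<in>{1..<n}. f i)"
  by (rule sum.reindex_bij_witness[of _ "\<lambda>i. n - i" "\<lambda>i. n - i"]) auto

lemma harm_eq_sum: "harm (n - 1) = (\<Sum>i\<in>{1..<n}. 1 / real i)"
proof -
  have "{1..n - 1} = {1..<n}" using n_ge_2 by auto
  then show ?thesis by (simp add: harm_def inverse_eq_divide)
qed

lemma partial_fractions:
  "i \<in> {1..<n} \<Longrightarrow> 1 / (real i * (real n - real i)) = (1 / real i + 1 / real (n - i)) / real n"
  by (simp add: of_nat_diff field_simps)

text \<open>Partial fractions split the sum into two harmonic sums, one for each end of the range.\<close>
lemma spread_mean_1: "spread_mean 1 = (real n - 1) * harm (n - 1)"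
proof -
  have "spread_mean 1 = (\<Sum>i\<in>{1..<n}. (real n - 1) / 2 * (1 / real i + 1 / real (n - i)))"
    unfolding spread_mean_def
  proof (rule sum.cong)
    fix i assume i: "i \<in> {1..<n}"
    have "1 / gain_prob i = real n * (real n - 1) / 2 * (1 / (real i * (real n - real i)))"
      by (simp add: gain_prob_def)
    also have "\<dots> = (real n - 1) / 2 * (1 / real i + 1 / real (n - i))"
      using n_ge_2 by (subst partial_fractions[OF i]) simp
    finally show "1 / gain_prob i = (real n - 1) / 2 * (1 / real i + 1 / real (n - i))" .
  qed simp
  also have "\<dots> = (real n - 1) * harm (n - 1)"
    using sum_reflect[of "\<lambda>i. 1 / real i"]
    by (simp only: sum_distrib_left[symmetric] sum.distrib harm_eq_sum) simp
  finally show ?thesis .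
qed

lemma spread_mean_2: "spread_mean 2 = (real n - 1) * harm (n - 1) - real n / 2"
proof -
  have "1 / gain_prob 1 = real n / 2"
    using n_ge_2 by (simp add: gain_prob_def divide_simps)
  moreover have "spread_mean 1 = 1 / gain_prob 1 + spread_mean 2"
    using spread_mean_Suc[of 1] n_ge_2 by (simp add: numeral_2_eq_2)
  ultimately show ?thesis using spread_mean_1 by simp
qed

section \<open>Exponential moments of the spreading time\<close>

text \<open>
  The exponential moment of the time \<open>T\<close> that an information needs to reach all sites from \<open>j\<close> of them,
  namely the expectation of \<open>(1 - \<theta>) powr (- T)\<close> with \<open>\<theta> = 2 \<alpha> / n\<close>. A geometric variable with success
  probability \<open>p > \<theta>\<close> contributes the factor \<open>1 / (1 - \<theta> / p)\<close>, and
  \<open>\<theta> / gain_prob i = \<alpha> (n - 1) / (i (n - i))\<close>.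
\<close>
definition spread_mgf :: "real \<Rightarrow> nat \<Rightarrow> real" where
  "spread_mgf \<alpha> j = (\<Prod>i\<in>{j..<n}. 1 / (1 - \<alpha> * (real n - 1) / (real i * (real n - real i))))"

text \<open>
  The slowest sizes are \<open>i = 1\<close> and \<open>i = n - 1\<close>; hence the exponential moment is finite for
  every \<open>\<alpha> < 1\<close>.
\<close>
lemma crossing_bound: "1 \<le> i \<Longrightarrow> i < n \<Longrightarrow> real n - 1 \<le> real i * (real n - real i)"
proof -
  assume "1 \<le> i" "i < n"
  then have "1 \<le> real i" "real i + 1 \<le> real n" by linarith+
  then have "0 \<le> (real i - 1) * (real n - real i - 1)"
    by (intro mult_nonneg_nonneg) auto
  then show ?thesis by (simp add: algebra_simps)
qed

lemma mgf_ratio_bounds: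
  assumes "0 < \<alpha>" "1 \<le> i" "i < n"
  shows "0 \<le> \<alpha> * (real n - 1) / (real i * (real n - real i))"
    "\<alpha> * (real n - 1) / (real i * (real n - real i)) \<le> \<alpha>"
proof -
  have pos: "0 < real i * (real n - real i)" using assms by simp
  show "0 \<le> \<alpha> * (real n - 1) / (real i * (real n - real i))"
    using assms pos n_ge_2 by (intro divide_nonneg_pos) auto
  show "\<alpha> * (real n - 1) / (real i * (real n - real i)) \<le> \<alpha>"
    using crossing_bound[OF assms(2,3)] pos assms(1)
    by (simp add: divide_le_eq)
qed

lemma spread_mgf_Suc:
  assumes "0 < \<alpha>" "\<alpha> < 1" "1 \<le> j" "j < n"
  shows "spread_mgf \<alpha> (Suc j)
    = (1 - \<alpha> * (real n - 1) / (real j * (real n - real j))) * spread_mgf \<alpha> j"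
  using mgf_ratio_bounds[OF assms(1,3,4)] assms
  unfolding spread_mgf_def by (subst (2) prod.atLeast_Suc_lessThan) auto

lemma spread_mgf_ge_1:
  assumes "0 < \<alpha>" "\<alpha> < 1" "1 \<le> j"
  shows "1 \<le> spread_mgf \<alpha> j"
  unfolding spread_mgf_def
proof (rule prod_ge_1)
  fix i assume "i \<in> {j..<n}"
  then have "1 \<le> i" "i < n" using assms by auto
  note x = mgf_ratio_bounds[OF assms(1) this]
  show "1 \<le> 1 / (1 - \<alpha> * (real n - 1) / (real i * (real n - real i)))"
    by (rule one_le_one_div_one_minus[OF x(1) le_less_trans[OF x(2) assms(2)]])
qed

lemma rate_bounds:
  assumes "0 < \<alpha>" "\<alpha> < 1"
  shows "0 \<le> 1 - 2 * \<alpha> / real n" "1 - 2 * \<alpha> / real n < 1"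
  using assms n_ge_2 by (auto simp: field_simps)

text \<open>
  Below full size, \<open>spread_mgf\<close> is an eigenfunction of the chain of set sizes with eigenvalue
  \<open>1 - 2 \<alpha> / n\<close>. Setting it to \<open>0\<close> at size \<open>n\<close> makes it a supersolution everywhere.
\<close>
lemma incomplete_le_geometric:
  assumes \<alpha>: "0 < \<alpha>" "\<alpha> < 1" and k: "k \<in> {1..n}" and c: "c \<in> configs"
  shows "unabsorbed (known_everywhere k) t c
    \<le> (1 - 2 * \<alpha> / real n) ^ t * spread_mgf \<alpha> (card (c k))"
proof -
  let ?F = "\<lambda>j. if j < n then spread_mgf \<alpha> j else 0"
  have "unabsorbed (known_everywhere k) t c \<le> (1 - 2 * \<alpha> / real n) ^ t * ?F (card (c k))"
  proof (rule unabsorbed_le_geometric[OF closed_configs c])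
    fix c assume c: "c \<in> configs"
    note cc = config_card[OF c k]
    have mgf: "1 \<le> spread_mgf \<alpha> (card (c k))" using spread_mgf_ge_1 \<alpha> cc by simp
    show "0 \<le> ?F (card (c k))" using mgf by simp
    show "1 \<le> ?F (card (c k))" if "c \<notin> known_everywhere k"
      using mgf that cc complete_iff[OF c k] by simp
    show "avg (\<lambda>e. ?F (card (spread c e k))) \<le> (1 - 2 * \<alpha> / real n) * ?F (card (c k))"
    proof (cases "card (c k) < n")
      case True
      let ?j = "card (c k)"
      have j: "1 \<le> ?j" "?j < n" using cc True by auto
      have "?F (Suc ?j) \<le> spread_mgf \<alpha> (Suc ?j)" using spread_mgf_ge_1[OF \<alpha>, of "Suc ?j"] by simp
      then have "gain_prob ?j * (?F (Suc ?j) - ?F ?j)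
          \<le> gain_prob ?j * (spread_mgf \<alpha> (Suc ?j) - spread_mgf \<alpha> ?j)"
        using True gain_prob_pos[OF j] by (intro mult_left_mono) auto
      also have "\<dots> = - (gain_prob ?j * (\<alpha> * (real n - 1) / (real ?j * (real n - real ?j))))
            * spread_mgf \<alpha> ?j"
        by (simp add: spread_mgf_Suc[OF \<alpha> j] algebra_simps)
      also have "gain_prob ?j * (\<alpha> * (real n - 1) / (real ?j * (real n - real ?j))) = 2 * \<alpha> / real n"
        using j n_ge_2 by (simp add: gain_prob_def)
      finally show ?thesis
        using True by (subst avg_card_spread[of c k, OF cc(3) refl, of ?F]) (simp add: algebra_simps)
    next
      case False
      then have "card (c k) = n" using cc by simp
      then have "gain_prob (card (c k)) = 0" by (simp add: gain_prob_def)
      then show ?thesis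
        using False by (subst avg_card_spread[of c k, OF cc(3) refl, of ?F]) simp
    qed
  qed (use rate_bounds[OF \<alpha>] in auto)
  also have "\<dots> \<le> (1 - 2 * \<alpha> / real n) ^ t * spread_mgf \<alpha> (card (c k))"
    using rate_bounds[OF \<alpha>] spread_mgf_ge_1[OF \<alpha>] config_card[OF c k]
    by (intro mult_left_mono) (auto intro: order_trans[of 0 1])
  finally show ?thesis .
qed

lemma incomplete_union_bound:
  assumes \<alpha>: "0 < \<alpha>" "\<alpha> < 1" and m: "m \<le> n"
  shows "unabsorbed (\<Inter>k\<in>{1..m}. known_everywhere k) t start
    \<le> real m * spread_mgf \<alpha> 1 * (1 - 2 * \<alpha> / real n) ^ t"
proof -
  have "unabsorbed (\<Inter>k\<in>{1..m}. known_everywhere k) t start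
      \<le> (\<Sum>k\<in>{1..m}. unabsorbed (known_everywhere k) t start)"
    by (rule unabsorbed_Inter_le) simp
  also have "\<dots> \<le> (\<Sum>k\<in>{1..m}. (1 - 2 * \<alpha> / real n) ^ t * spread_mgf \<alpha> 1)"
  proof (rule sum_mono)
    fix k assume "k \<in> {1..m}"
    then show "unabsorbed (known_everywhere k) t start \<le> (1 - 2 * \<alpha> / real n) ^ t * spread_mgf \<alpha> 1"
      using incomplete_le_geometric[OF \<alpha> _ start_in_configs, of k t] m by (simp add: start_def)
  qed
  finally show ?thesis by (simp add: ac_simps)
qed

text \<open>
  To first order a factor \<open>1 / (1 - x)\<close> is \<open>exp x\<close>, and the sum of the \<open>x\<close> is at most twice \<open>\<alpha>\<close> times the
  harmonic number, once for each end of the range. The second-order terms are summable, so that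
  they contribute only a constant, which blows up as \<open>\<alpha>\<close> tends to \<open>1\<close>.
\<close>
lemma spread_mgf_le:
  assumes \<alpha>: "0 < \<alpha>" "\<alpha> < 1"
  shows "spread_mgf \<alpha> 1 \<le> exp (2 * \<alpha> * harm (n - 1) + 8 / (1 - \<alpha>))"
proof -
  define x where "x i = \<alpha> * (real n - 1) / (real i * (real n - real i))" for i
  define b where "b i = 1 / real i + 1 / real (n - i)" for i
  have factor: "1 / (1 - x i) \<le> exp (\<alpha> * b i + (b i)\<^sup>2 / (1 - \<alpha>))" if i: "i \<in> {1..<n}" for i
  proof -
    have x: "0 \<le> x i" "x i \<le> \<alpha>" using mgf_ratio_bounds[OF \<alpha>(1), of i] i by (auto simp: x_def)
    have b: "0 \<le> b i" by (simp add: b_def)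
    have "x i = \<alpha> * (real n - 1) * (1 / (real i * (real n - real i)))" by (simp add: x_def)
    also have "\<dots> = (real n - 1) / real n * (\<alpha> * b i)"
      by (subst partial_fractions[OF i]) (simp add: b_def)
    also have "\<dots> \<le> 1 * (\<alpha> * b i)"
      using n_ge_2 b \<alpha> by (intro mult_right_mono) auto
    finally have xb: "x i \<le> \<alpha> * b i" by simp
    also have "\<alpha> * b i \<le> b i" using b \<alpha> by (simp add: mult_left_le_one_le)
    \<comment> \<open>the second-order bound may drop the factor \<open>\<alpha>\<close>, since it only enters a constant\<close>
    finally have xsq: "(x i)\<^sup>2 \<le> (b i)\<^sup>2" using x by (intro power_mono) auto
    have "1 / (1 - x i) = 1 + x i / (1 - x i)" using x \<alpha> by (simp add: field_simps)
    also have "\<dots> \<le> exp (x i / (1 - x i))" by (rule exp_ge_add_one_self)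
    also have "x i / (1 - x i) = x i + (x i)\<^sup>2 / (1 - x i)"
      using x \<alpha> by (simp add: field_simps power2_eq_square)
    also have "exp \<dots> \<le> exp (\<alpha> * b i + (b i)\<^sup>2 / (1 - \<alpha>))"
      using x \<alpha> xb xsq by (simp, intro add_mono frac_le) auto
    finally show ?thesis .
  qed
  have "spread_mgf \<alpha> 1 \<le> (\<Prod>i\<in>{1..<n}. exp (\<alpha> * b i + (b i)\<^sup>2 / (1 - \<alpha>)))"
    unfolding spread_mgf_def
  proof (rule prod_mono)
    fix i assume i: "i \<in> {1..<n}"
    then have "1 \<le> i" "i < n" by auto
    note x = mgf_ratio_bounds[OF \<alpha>(1) this]
    have "1 \<le> 1 / (1 - \<alpha> * (real n - 1) / (real i * (real n - real i)))"
      by (rule one_le_one_div_one_minus[OF x(1) le_less_trans[OF x(2) \<alpha>(2)]])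
    then show "0 \<le> 1 / (1 - \<alpha> * (real n - 1) / (real i * (real n - real i)))
      \<and> 1 / (1 - \<alpha> * (real n - 1) / (real i * (real n - real i)))
        \<le> exp (\<alpha> * b i + (b i)\<^sup>2 / (1 - \<alpha>))"
      using factor[OF i] unfolding x_def by linarith
  qed
  also have "\<dots> = exp (\<alpha> * (\<Sum>i\<in>{1..<n}. b i) + (\<Sum>i\<in>{1..<n}. (b i)\<^sup>2) / (1 - \<alpha>))"
    by (simp add: exp_sum[symmetric] sum.distrib sum_distrib_left sum_divide_distrib)
  also have "\<dots> \<le> exp (2 * \<alpha> * harm (n - 1) + 8 / (1 - \<alpha>))"
  proof -
    have "(\<Sum>i\<in>{1..<n}. b i) = 2 * harm (n - 1)"
      using sum_reflect[of "\<lambda>i. 1 / real i"]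
      by (simp only: b_def sum.distrib harm_eq_sum)
    moreover have "(\<Sum>i\<in>{1..<n}. (b i)\<^sup>2) \<le> 8"
    proof -
      have "(b i)\<^sup>2 \<le> 2 * (1 / (real i)\<^sup>2) + 2 * (1 / (real (n - i))\<^sup>2)" for i
        using sum_squares_bound[of "1 / real i" "1 / real (n - i)"]
        by (simp add: b_def power2_sum power_divide del: of_nat_diff)
      then have "(\<Sum>i\<in>{1..<n}. (b i)\<^sup>2)
          \<le> (\<Sum>i\<in>{1..<n}. 2 * (1 / (real i)\<^sup>2) + 2 * (1 / (real (n - i))\<^sup>2))"
        by (rule sum_mono)
      also have "\<dots> = 4 * (\<Sum>i\<in>{1..<n}. 1 / (real i)\<^sup>2)"
        using sum_reflect[of "\<lambda>i. 1 / (real i)\<^sup>2"]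
        by (simp only: sum.distrib sum_distrib_left[symmetric])
      also have "\<dots> \<le> 8" using sum_inverse_squares_le_2[of n] by simp
      finally show ?thesis .
    qed
    ultimately show ?thesis using \<alpha> by (simp add: divide_right_mono)
  qed
  finally show ?thesis .
qed

section \<open>Expected propagation times\<close>

text \<open>
  The expected time until the first \<open>m\<close> informations are known everywhere, as a real number; it
  is meaningful for \<open>m \<le> n\<close>, where the series converges.
\<close>
definition expected_time :: "nat \<Rightarrow> real" where
  "expected_time m = (\<Sum>t. unabsorbed (\<Inter>k\<in>{1..m}. known_everywhere k) t start)"

lemma summable_unabsorbed:
  assumes "m \<le> n"
  shows "summable (\<lambda>t. unabsorbed (\<Inter>k\<in>{1..m}. known_everywhere k) t start)"
proof (rule summable_comparison_test'[where N = 0])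
  show "summable (\<lambda>t. real m * spread_mgf (1/2) 1 * (1 - 2 * (1/2) / real n) ^ t)"
    using rate_bounds[of "1/2"] by (intro summable_mult summable_geometric) auto
qed (use incomplete_union_bound[of "1/2" m] assms unabsorbed_nonneg in auto)

lemma mean_time_eq: "m \<le> n \<Longrightarrow> mean_time n m = ennreal (expected_time m)"
  unfolding mean_time_eq_suminf expected_time_def
  by (intro suminf_ennreal2 unabsorbed_nonneg summable_unabsorbed)

text \<open>
  The boundary term of the lower comparison disappears in the limit because the probabilities of
  incompleteness are summable.
\<close>
lemma expected_time_ge:
  assumes "m \<le> n" and le: "\<And>N. x \<le> (\<Sum>t<N. unabsorbed (\<Inter>k\<in>{1..m}. known_everywhere k) t start)
      + G * unabsorbed (\<Inter>k\<in>{1..m}. known_everywhere k) N start"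
  shows "x \<le> expected_time m"
proof -
  note s = summable_unabsorbed[OF assms(1)]
  have "(\<lambda>N. (\<Sum>t<N. unabsorbed (\<Inter>k\<in>{1..m}. known_everywhere k) t start)
      + G * unabsorbed (\<Inter>k\<in>{1..m}. known_everywhere k) N start) \<longlonglongrightarrow> expected_time m + G * 0"
    unfolding expected_time_def
    by (intro tendsto_intros summable_LIMSEQ[OF s] summable_LIMSEQ_zero[OF s])
  then show ?thesis using le by (intro LIMSEQ_le_const[of _ "expected_time m"]) auto
qed

text \<open>
  Here the potential has drift exactly \<open>-1\<close>, so that both comparisons apply to it.
\<close>
lemma expected_time_1: "expected_time 1 = (real n - 1) * harm (n - 1)"
proof -
  let ?g = "\<lambda>c. spread_mean (card (c 1))"
  have 1: "1 \<in> {1..n}" using n_ge_2 by simp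
  have D: "(\<Inter>k\<in>{1..1}. known_everywhere k) = known_everywhere 1" by simp
  have n: "spread_mean n = 0" by (simp add: spread_mean_def)
  have drift: "1 + avg (\<lambda>e. ?g (spread c e)) = ?g c" if "c \<in> configs" "c \<notin> known_everywhere 1" for c
    using avg_spread_mean[OF that(1) 1] config_card[OF that(1) 1] complete_iff[OF that(1) 1] that
    by simp
  have "expected_time 1 \<le> ?g start"
    unfolding expected_time_def D
  proof (rule suminf_le_const)
    show "summable (\<lambda>t. unabsorbed (known_everywhere 1) t start)"
      using summable_unabsorbed[of 1] n_ge_2 by simp
    show "(\<Sum>t<N. unabsorbed (known_everywhere 1) t start) \<le> ?g start" for N
    proof (rule sum_unabsorbed_le[OF closed_configs start_in_configs])
      show "closed_under_step (known_everywhere 1)" using closed_complete[of "{1}"] by simp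
    qed (use drift spread_mean_nonneg in auto)
  qed
  moreover have "?g start \<le> expected_time 1"
  proof (rule expected_time_ge[where G = "spread_mean 1"])
    show "?g start \<le> (\<Sum>t<N. unabsorbed (\<Inter>k\<in>{1..1}. known_everywhere k) t start)
      + spread_mean 1 * unabsorbed (\<Inter>k\<in>{1..1}. known_everywhere k) N start" for N
      unfolding D
    proof (rule sum_unabsorbed_ge[OF closed_configs start_in_configs])
      fix c assume c: "c \<in> configs"
      show "?g c \<le> spread_mean 1" using config_card[OF c 1] by (intro spread_mean_le) auto
      show "?g c \<le> 0" if "c \<in> known_everywhere 1" using that complete_iff[OF c 1] n by simp
      show "?g c \<le> 1 + avg (\<lambda>e. ?g (spread c e))" if "c \<notin> known_everywhere 1"
        using drift[OF c that] by simp
    qed (rule spread_mean_nonneg)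
  qed (use n_ge_2 in auto)
  ultimately show ?thesis using spread_mean_1 by (simp add: start_def)
qed

section \<open>Lower bound: untouched sites, then spreading from two sites\<close>

text \<open>
  For configurations reached from the start, these are the sites that no edge has touched yet.
\<close>
definition untouched :: "(nat \<Rightarrow> nat set) \<Rightarrow> nat set" where
  "untouched c = {x \<in> {1..n}. c x = {x}}"

text \<open>
  Touching all of \<open>u\<close> untouched sites takes on average at least this multiple of the harmonic number
  of \<open>u\<close>. Since an edge touches on average \<open>2 u / n\<close> of them, \<open>n / 2\<close> is the natural
  scale; the reciprocal of the constant here is \<open>2 / n + 1 / (n (n - 1))\<close>, where the second term pays
  for edges that touch two untouched sites at once.
\<close>
definition touch_scale :: real where
  "touch_scale = real n * (real n - 1) / (2 * real n - 1)"

text \<open>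
  A lower bound for the expected remaining time. While there are untouched sites, all of them have
  to be touched, and then an information known by two sites remains to be spread. Afterwards
  the information that is known least gives the bound; taking the maximum avoids
  recording which one was released last, since a maximum of potentials with drift at least \<open>-1\<close> has
  drift at least \<open>-1\<close>.
\<close>
definition lower_potential :: "(nat \<Rightarrow> nat set) \<Rightarrow> real" where
  "lower_potential c =
     (if untouched c = {} then Max ((\<lambda>k. spread_mean (card (c k))) ` {1..n})
      else spread_mean 2 + touch_scale * harm (card (untouched c)))"

lemma touch_scale_pos: "0 < touch_scale"
  using n_ge_2 by (simp add: touch_scale_def)

lemma untouched_spread:
  assumes "c \<in> configs" "e \<in> complete_edges n"
  shows "untouched (spread c e) = untouched c - e"
proof -
  have "spread c e x = {x} \<longleftrightarrow> c x = {x} \<and> x \<notin> e" if x: "x \<in> {1..n}" for x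
  proof -
    have xc: "x \<in> c x" using assms(1) x by (simp add: configs_def)
    have e: "e \<noteq> {}" "\<not> e \<subseteq> {x}"
      using assms(2) card_mono[of "{x}" e] by (auto simp: complete_edges_def)
    show ?thesis
    proof (cases "x \<in> e")
      case True
      then have "spread c e x = c x \<union> e" using xc by (auto simp: spread_def)
      then show ?thesis using True e by auto
    next
      case False
      show ?thesis
      proof (cases "c x \<inter> e = {}")
        case True
        then show ?thesis using False by (simp add: spread_def)
      next
        case ne: False
        then have "spread c e x = c x \<union> e" "c x \<noteq> {x}" using False by (auto simp: spread_def)
        then show ?thesis using e by auto
      qed
    qed
  qed
  then show ?thesis by (auto simp: untouched_def)
qed

lemma card_edges_at:
  assumes "x \<in> {1..n}"
  shows "card {e \<in> complete_edges n. x \<in> e} = n - 1"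
proof -
  have "{e \<in> complete_edges n. x \<in> e} = {e \<in> complete_edges n. {x} \<inter> e \<noteq> {} \<and> \<not> e \<subseteq> {x}}"
    by (auto simp: complete_edges_def card_2_iff)
  then show ?thesis using card_crossing_edges[of "{x}"] assms by simp
qed

lemma sum_card_Int_edges:
  assumes U: "U \<subseteq> {1..n}"
  shows "(\<Sum>e\<in>complete_edges n. card (U \<inter> e)) = card U * (n - 1)"
proof -
  have fin: "finite U" using U by (rule finite_subset) simp
  have "(\<Sum>e\<in>complete_edges n. card (U \<inter> e)) = (\<Sum>e\<in>complete_edges n. \<Sum>x\<in>U. if x \<in> e then 1 else 0)"
    using fin by (simp add: sum.If_cases Int_def)
  also have "\<dots> = (\<Sum>x\<in>U. card {e \<in> complete_edges n. x \<in> e})"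
    by (subst sum.swap) (simp add: sum.If_cases finite_complete_edges Int_def)
  also have "\<dots> = (\<Sum>x\<in>U. n - 1)"
    using U by (intro sum.cong refl card_edges_at) auto
  finally show ?thesis by simp
qed

lemma card_edges_inside:
  assumes U: "U \<subseteq> {1..n}"
  shows "real (card {e \<in> complete_edges n. e \<subseteq> U}) = real (card U) * (real (card U) - 1) / 2"
proof -
  have "finite U" using U by (rule finite_subset) simp
  moreover have "{e \<in> complete_edges n. e \<subseteq> U} = {e. e \<subseteq> U \<and> card e = 2}"
    using U by (auto simp: complete_edges_def simp del: One_nat_def)
  ultimately have "card {e \<in> complete_edges n. e \<subseteq> U} = card U choose 2"
    using n_subsets[of U 2] by simp
  then show ?thesis
    by (cases "card U") (simp_all add: choose_two real_of_nat_div algebra_simps)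
qed

text \<open>
  In one step the harmonic number of the count of untouched sites drops on average by at most the
  reciprocal of \<open>touch_scale\<close>. Double counting shows that the \<open>1/u\<close> charges add up to \<open>n - 1\<close> over all edges,
  and the excess of the \<open>u choose 2\<close> edges inside the untouched set adds up to \<open>1/2\<close>.
\<close>
lemma avg_harm_drop:
  assumes U: "U \<subseteq> {1..n}" "U \<noteq> {}"
  shows "touch_scale * (harm (card U) - avg (\<lambda>e. harm (card (U - e)))) \<le> 1"
proof -
  let ?E = "complete_edges n" and ?u = "real (card U)"
  have fin: "finite U" using U(1) by (rule finite_subset) simp
  then have u: "?u > 0" using U(2) by (simp add: card_gt_0_iff)
  have "(\<Sum>e\<in>?E. harm (card U) - harm (card (U - e)))
      \<le> (\<Sum>e\<in>?E. real (card (U \<inter> e)) / ?u + (if e \<subseteq> U then 1 / (?u * (?u - 1)) else 0))"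
    using fin by (intro sum_mono harm_diff_card_le) (auto simp: complete_edges_def)
  also have "\<dots> = real (\<Sum>e\<in>?E. card (U \<inter> e)) / ?u
      + real (card {e \<in> ?E. e \<subseteq> U}) * (1 / (?u * (?u - 1)))"
    by (simp add: sum.distrib sum_divide_distrib sum.If_cases finite_complete_edges Int_def)
  also have "real (\<Sum>e\<in>?E. card (U \<inter> e)) / ?u = real n - 1"
    unfolding sum_card_Int_edges[OF U(1)] using u n_ge_2 by (simp add: of_nat_diff)
  also have "real (card {e \<in> ?E. e \<subseteq> U}) * (1 / (?u * (?u - 1))) \<le> 1 / 2"
    unfolding card_edges_inside[OF U(1)] by (simp add: divide_simps)
  finally have *: "(\<Sum>e\<in>?E. harm (card U) - harm (card (U - e))) \<le> (2 * real n - 1) / 2"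
    by simp
  have "harm (card U) - avg (\<lambda>e. harm (card (U - e)))
      = (\<Sum>e\<in>?E. harm (card U) - harm (card (U - e))) / real (card ?E)"
    using card_E_pos by (simp add: avg_def sum_subtractf diff_divide_distrib)
  also have "\<dots> \<le> (2 * real n - 1) / 2 / real (card ?E)"
    using * by (intro divide_right_mono) auto
  also have "\<dots> = 1 / touch_scale"
    unfolding real_card_edges touch_scale_def using n_ge_2 by (simp add: divide_simps)
  finally show ?thesis using touch_scale_pos by (simp add: field_simps)
qed

lemma spread_mean_le_Max:
  "k \<in> {1..n} \<Longrightarrow> spread_mean (card (c k)) \<le> Max ((\<lambda>k. spread_mean (card (c k))) ` {1..n})"
  by (intro Max_ge) auto

text \<open>
  The two stages fit together because the edge that touches the last untouched site \<open>x\<close> makes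
  the information of \<open>x\<close> known at exactly the two ends of that edge.
\<close>
lemma lower_potential_drift:
  assumes c: "c \<in> configs"
  shows "lower_potential c \<le> 1 + avg (\<lambda>e. lower_potential (spread c e))"
proof (cases "untouched c = {}")
  case True
  let ?S = "\<lambda>c k. spread_mean (card (c k))"
  \<comment> \<open>once all sites are touched, an information attaining the maximum carries the drift alone\<close>
  have "Max (?S c ` {1..n}) \<in> ?S c ` {1..n}" using n_ge_2 by (intro Max_in) auto
  then obtain k where k: "k \<in> {1..n}" "Max (?S c ` {1..n}) = ?S c k" by auto
  have "?S c k \<le> 1 + avg (\<lambda>e. ?S (spread c e) k)"
  proof (cases "card (c k) < n")
    case True
    then show ?thesis using avg_spread_mean[OF c k(1)] by simp
  next
    case False
    then have "card (c k) = n" using config_card[OF c k(1)] by simp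
    then have "?S c k = 0" by (simp add: spread_mean_def)
    then show ?thesis
      using avg_nonneg[of "\<lambda>e. ?S (spread c e) k"] spread_mean_nonneg by simp
  qed
  also have "avg (\<lambda>e. ?S (spread c e) k) \<le> avg (\<lambda>e. lower_potential (spread c e))"
  proof (rule avg_mono)
    fix e assume "e \<in> complete_edges n"
    then have "untouched (spread c e) = {}" using untouched_spread[OF c] True by simp
    then show "?S (spread c e) k \<le> lower_potential (spread c e)"
      using spread_mean_le_Max[OF k(1), of "spread c e"] by (simp add: lower_potential_def)
  qed
  finally show ?thesis using True k by (simp add: lower_potential_def)
next
  case False
  let ?U = "untouched c"
  have *: "spread_mean 2 + touch_scale * harm (card (?U - e)) \<le> lower_potential (spread c e)"
    if e: "e \<in> complete_edges n" for e
  proof (cases "?U - e = {}")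
    case True
    with False obtain x where x: "x \<in> ?U" "x \<in> e" by auto
    then have "spread c e x = e" "x \<in> {1..n}" by (auto simp: untouched_def spread_def)
    moreover have "card e = 2" using e by (simp add: complete_edges_def)
    ultimately have "spread_mean 2 \<le> Max ((\<lambda>k. spread_mean (card (spread c e k))) ` {1..n})"
      using spread_mean_le_Max[of x "spread c e"] by simp
    moreover have "harm (card (?U - e)) = (0 :: real)" unfolding True by (simp add: harm_def)
    moreover have "untouched (spread c e) = {}" using True untouched_spread[OF c e] by simp
    ultimately show ?thesis by (simp only: lower_potential_def if_True) simp
  next
    case False
    then show ?thesis using untouched_spread[OF c e] by (simp add: lower_potential_def)
  qed
  have "spread_mean 2 + touch_scale * avg (\<lambda>e. harm (card (?U - e)))
      = avg (\<lambda>e. spread_mean 2 + touch_scale * harm (card (?U - e)))"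
    by (simp add: avg_add avg_cmult)
  also have "\<dots> \<le> avg (\<lambda>e. lower_potential (spread c e))"
    by (intro avg_mono *)
  finally have "spread_mean 2 + touch_scale * avg (\<lambda>e. harm (card (?U - e)))
      \<le> avg (\<lambda>e. lower_potential (spread c e))" .
  moreover have "?U \<subseteq> {1..n}" by (auto simp: untouched_def)
  ultimately show ?thesis
    using avg_harm_drop[of ?U] False by (simp add: lower_potential_def algebra_simps)
qed

lemma lower_potential_le:
  assumes c: "c \<in> configs"
  shows "lower_potential c \<le> spread_mean 1 + touch_scale * harm n"
proof (cases "untouched c = {}")
  case True
  have "Max ((\<lambda>k. spread_mean (card (c k))) ` {1..n}) \<le> spread_mean 1"
    using config_card[OF c] n_ge_2 by (intro Max.boundedI) (auto intro!: spread_mean_le)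
  then show ?thesis using True touch_scale_pos
    by (simp add: lower_potential_def add_increasing2)
next
  case False
  have "card (untouched c) \<le> card {1..n}" by (intro card_mono) (auto simp: untouched_def)
  then have "(harm (card (untouched c)) :: real) \<le> harm n" by (intro harm_mono) simp
  then show ?thesis using False touch_scale_pos spread_mean_le[of 1 2]
    by (simp add: lower_potential_def add_mono)
qed

lemma lower_potential_complete:
  assumes c: "c \<in> configs" "c \<in> (\<Inter>k\<in>{1..n}. known_everywhere k)"
  shows "lower_potential c = 0"
proof -
  have card: "card (c k) = n" if "k \<in> {1..n}" for k
    using complete_iff[OF c(1) that] c(2) that by auto
  have "untouched c = {}"
  proof (rule ccontr)
    assume "untouched c \<noteq> {}"
    then obtain x where "x \<in> {1..n}" "c x = {x}" by (auto simp: untouched_def)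
    then show False using card[of x] n_ge_2 by simp
  qed
  moreover have "(\<lambda>k. spread_mean (card (c k))) ` {1..n} = {spread_mean n}"
    using card n_ge_2 by (auto simp: image_iff intro!: exI[of _ n])
  ultimately show ?thesis by (simp add: lower_potential_def spread_mean_def)
qed

lemma expected_time_n_ge: "(real n - 1) * harm (n - 1) - real n / 2 + touch_scale * harm n \<le> expected_time n"
proof -
  let ?G = "spread_mean 1 + touch_scale * harm n"
  have "lower_potential start \<le> expected_time n"
  proof (rule expected_time_ge[where G = ?G])
    show "lower_potential start \<le> (\<Sum>t<N. unabsorbed (\<Inter>k\<in>{1..n}. known_everywhere k) t start)
        + ?G * unabsorbed (\<Inter>k\<in>{1..n}. known_everywhere k) N start" for N
    proof (rule sum_unabsorbed_ge[OF closed_configs start_in_configs])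
      show "0 \<le> ?G" using spread_mean_nonneg touch_scale_pos by simp
    qed (simp_all only: lower_potential_le lower_potential_drift lower_potential_complete order_refl)
  qed simp
  moreover have "untouched start = {1..n}" by (auto simp: untouched_def start_def)
  ultimately show ?thesis
    using n_ge_2 by (simp add: lower_potential_def spread_mean_2)
qed

section \<open>Upper bound: union bound over the informations\<close>

text \<open>
  With \<open>\<theta> = 2 \<alpha> / n\<close> the union bound at time \<open>t\<close> is at most \<open>exp L (1 - \<theta>)\<^sup>t\<close>, where
  \<open>L = (1 + 2 \<alpha>) H + 8 / (1 - \<alpha>)\<close> with the harmonic number \<open>H\<close> of \<open>n - 1\<close>. It drops below \<open>1\<close> at
  about \<open>t = L / \<theta>\<close>. Up to then probabilities are bounded by \<open>1\<close>, and from then on by a geometric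
  series with sum \<open>1 / \<theta>\<close>, of lower order than \<open>L / \<theta>\<close>.
\<close>
lemma expected_time_n_le:
  assumes \<alpha>: "0 < \<alpha>" "\<alpha> < 1"
  shows "expected_time n \<le> real n / (2 * \<alpha>) * ((1 + 2 * \<alpha>) * harm (n - 1) + 8 / (1 - \<alpha>) + 1) + 1"
proof -
  let ?u = "\<lambda>t. unabsorbed (\<Inter>k\<in>{1..n}. known_everywhere k) t start"
  define \<theta> where "\<theta> = 2 * \<alpha> / real n"
  define L where "L = (1 + 2 * \<alpha>) * harm (n - 1) + 8 / (1 - \<alpha>)"
  \<comment> \<open>the time from which the union bound is at most 1\<close>
  define T where "T = nat \<lceil>L / \<theta>\<rceil>"
  have \<theta>: "0 < \<theta>" "0 \<le> 1 - \<theta>" "1 - \<theta> < 1"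
    using \<alpha> n_ge_2 rate_bounds[OF \<alpha>] by (auto simp: \<theta>_def)
  have L: "0 \<le> L" using \<alpha> by (simp add: L_def)
  have "0 \<le> L / \<theta>" using L \<theta> by simp
  then have T: "L / \<theta> \<le> real T" "real T \<le> L / \<theta> + 1"
    unfolding T_def by linarith+
  have "real n * spread_mgf \<alpha> 1 \<le> exp L"
  proof -
    have "ln (real (n - 1) + 1) \<le> harm (n - 1)" by (rule ln_le_harm)
    moreover have "real (n - 1) + 1 = real n" using n_ge_2 by simp
    ultimately have "ln (real n) \<le> harm (n - 1)" by simp
    then have "real n \<le> exp (harm (n - 1))"
      using n_ge_2 by (metis exp_le_cancel_iff exp_ln of_nat_0_less_iff less_le_trans pos2)
    then have "real n * spread_mgf \<alpha> 1
        \<le> exp (harm (n - 1)) * exp (2 * \<alpha> * harm (n - 1) + 8 / (1 - \<alpha>))"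
      using spread_mgf_le[OF \<alpha>] spread_mgf_ge_1[OF \<alpha>, of 1] by (intro mult_mono) auto
    then show ?thesis by (simp add: L_def exp_add[symmetric] algebra_simps)
  qed
  moreover have "(1 - \<theta>) ^ T \<le> exp (- L)"
  proof -
    have "(1 - \<theta>) ^ T \<le> exp (- \<theta>) ^ T"
      using \<theta> exp_ge_add_one_self[of "- \<theta>"] by (intro power_mono) auto
    also have "\<dots> = exp (- (\<theta> * real T))" by (simp add: exp_of_nat_mult[symmetric] ac_simps)
    also have "\<dots> \<le> exp (- L)" using T \<theta> by (simp add: field_simps)
    finally show ?thesis .
  qed
  ultimately have "real n * spread_mgf \<alpha> 1 * (1 - \<theta>) ^ T \<le> exp L * exp (- L)"
    using \<theta> by (intro mult_mono) auto
  then have start: "real n * spread_mgf \<alpha> 1 * (1 - \<theta>) ^ T \<le> 1" by (simp add: exp_minus)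
  have tail: "?u (t + T) \<le> (1 - \<theta>) ^ t" for t
  proof -
    have "?u (t + T) \<le> (1 - \<theta>) ^ t * (real n * spread_mgf \<alpha> 1 * (1 - \<theta>) ^ T)"
      using incomplete_union_bound[OF \<alpha>, of n "t + T"] by (simp add: \<theta>_def power_add ac_simps)
    also have "\<dots> \<le> (1 - \<theta>) ^ t * 1" using start \<theta> by (intro mult_left_mono) auto
    finally show ?thesis by simp
  qed
  have s: "summable ?u" by (rule summable_unabsorbed) simp
  have "expected_time n = (\<Sum>t. ?u (t + T)) + (\<Sum>t<T. ?u t)"
    unfolding expected_time_def by (rule suminf_split_initial_segment[OF s])
  also have "(\<Sum>t. ?u (t + T)) \<le> (\<Sum>t. (1 - \<theta>) ^ t)"
    using \<theta> s tail by (intro suminf_le) (auto intro: summable_geometric summable_ignore_initial_segment)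
  also have "(\<Sum>t. (1 - \<theta>) ^ t) = 1 / \<theta>" using \<theta> by (simp add: suminf_geometric)
  also have "(\<Sum>t<T. ?u t) \<le> (\<Sum>t<T. 1)" by (intro sum_mono unabsorbed_le_1)
  finally have "expected_time n \<le> 1 / \<theta> + real T" by simp
  also have "\<dots> \<le> 1 / \<theta> + (L / \<theta> + 1)" using T by simp
  also have "\<dots> = real n / (2 * \<alpha>) * (L + 1) + 1"
    using \<alpha> n_ge_2 by (simp add: \<theta>_def field_simps)
  finally show ?thesis by (simp add: L_def)
qed

end

section \<open>The limit of the ratio\<close>

text \<open>
  The denominator is the expected propagation time of one information.
\<close>
definition gossip_ratio :: "nat \<Rightarrow> real" where
  "gossip_ratio n = gossip.expected_time n n / ((real n - 1) * harm (n - 1))"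

lemma mean_time_ratio:
  assumes "2 \<le> n"
  shows "mean_time n n / mean_time n 1 = ennreal (gossip_ratio n)"
proof -
  interpret gossip n by unfold_locales fact
  have "0 \<le> expected_time n" unfolding expected_time_def
    by (intro suminf_nonneg summable_unabsorbed unabsorbed_nonneg) simp
  moreover have "0 < expected_time 1" unfolding expected_time_1 using assms by simp
  ultimately show ?thesis
    using assms expected_time_1 by (simp add: mean_time_eq divide_ennreal gossip_ratio_def)
qed

text \<open>
  Spreading from one site accounts for \<open>1\<close> and the touching of all sites for \<open>1/2\<close>. The loss comes from
  starting the second stage with two informed sites instead of one.
\<close>
lemma gossip_ratio_ge:
  assumes "2 \<le> n"
  shows "3 / 2 - 1 / harm (n - 1) \<le> gossip_ratio n"
proof -
  interpret gossip n by unfold_locales fact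
  let ?H = "harm (n - 1) :: real"
  have H: "0 < ?H" using assms by simp
  have "(real n - 1) / 2 \<le> touch_scale"
    using assms by (simp add: touch_scale_def field_simps)
  moreover have "?H \<le> harm n" by (rule harm_mono) simp
  ultimately have "(real n - 1) / 2 * ?H \<le> touch_scale * harm n"
    using H touch_scale_pos by (intro mult_mono) auto
  moreover have "real n / 2 \<le> real n - 1" using assms by simp
  ultimately have "(3 / 2) * ((real n - 1) * ?H) - (real n - 1) \<le> expected_time n"
    using expected_time_n_ge by (simp add: algebra_simps)
  moreover have "((3 / 2) * (a * h) - a) / (a * h) = 3 / 2 - 1 / h" if "0 < a" "0 < h" for a h :: real
    using that by (simp add: field_simps)
  moreover have "0 < real n - 1" using assms by simp
  ultimately show ?thesis
    unfolding gossip_ratio_def using H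
    by (metis divide_right_mono less_imp_le mult_pos_pos)
qed

text \<open>
  For fixed \<open>\<alpha>\<close> the bound tends to \<open>(1 + 2 \<alpha>) / (2 \<alpha>)\<close>, which approaches \<open>3/2\<close> as \<open>\<alpha>\<close> tends to \<open>1\<close>.
\<close>
lemma gossip_ratio_le:
  assumes "2 \<le> n" and \<alpha>: "0 < \<alpha>" "\<alpha> < 1"
  shows "gossip_ratio n \<le> (real n / (real n - 1)) / (2 * \<alpha>)
      * ((1 + 2 * \<alpha>) + (8 / (1 - \<alpha>) + 1) / harm (n - 1)) + 1 / harm (n - 1)"
proof -
  interpret gossip n by unfold_locales fact
  let ?H = "harm (n - 1) :: real"
  have H: "0 < ?H" using assms by simp
  have n1: "0 < real n - 1" using assms by simp
  have "gossip_ratio n \<le> (real n / (2 * \<alpha>) * ((1 + 2 * \<alpha>) * ?H + 8 / (1 - \<alpha>) + 1) + 1)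
      / ((real n - 1) * ?H)"
    unfolding gossip_ratio_def using H n1 by (intro divide_right_mono expected_time_n_le \<alpha>) auto
  also have "\<dots> = (real n / (real n - 1)) / (2 * \<alpha>)
      * (((1 + 2 * \<alpha>) * ?H + (8 / (1 - \<alpha>) + 1)) / ?H) + 1 / ((real n - 1) * ?H)"
  proof -
    have "(a / b * x + 1) / (m * h) = a / m / b * (x / h) + 1 / (m * h)" for a b m h x :: real
      by (simp add: add_divide_distrib)
    then show ?thesis by (simp only: add.assoc)
  qed
  also have "((1 + 2 * \<alpha>) * ?H + (8 / (1 - \<alpha>) + 1)) / ?H = (1 + 2 * \<alpha>) + (8 / (1 - \<alpha>) + 1) / ?H"
    using H by (simp add: add_divide_distrib del: harm_pos_iff)
  also have "1 / ((real n - 1) * ?H) \<le> 1 / ?H"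
    using H assms by (simp add: frac_le)
  finally show ?thesis by simp
qed

lemma inverse_harm_tendsto_0: "(\<lambda>n. 1 / harm (n - 1) :: real) \<longlonglongrightarrow> 0"
  by (rule tendsto_divide_0[OF tendsto_const])
     (intro filterlim_at_top_imp_at_infinity filterlim_compose[OF harm_at_top] filterlim_minus_const_nat_at_top)

lemma gossip_ratio_tendsto: "gossip_ratio \<longlonglongrightarrow> 3 / 2"
proof (rule order_tendstoI)
  fix a :: real assume a: "a < 3 / 2"
  have "(\<lambda>n. 3 / 2 - 1 / harm (n - 1) :: real) \<longlonglongrightarrow> 3 / 2 - 0"
    by (intro tendsto_intros inverse_harm_tendsto_0)
  then have "eventually (\<lambda>n. a < 3 / 2 - 1 / harm (n - 1)) sequentially"
    using a by (intro order_tendstoD(1)) auto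
  then show "eventually (\<lambda>n. a < gossip_ratio n) sequentially"
    using eventually_ge_at_top[of 2]
    by eventually_elim (use gossip_ratio_ge in fastforce)
next
  fix a :: real assume a: "3 / 2 < a"
  have "((\<lambda>x::real. 1 / (2 * x) * (1 + 2 * x)) \<longlongrightarrow> 1 / (2 * 1) * (1 + 2 * 1)) (at_left 1)"
    by (intro tendsto_intros) auto
  then have "eventually (\<lambda>x::real. 1 / (2 * x) * (1 + 2 * x) < a) (at_left 1)"
    using a by (intro order_tendstoD(2)) auto
  moreover have "eventually (\<lambda>x::real. x \<in> {0<..<1}) (at_left 1)"
    by (rule eventually_at_left_real) simp
  ultimately have "eventually (\<lambda>x::real. 1 / (2 * x) * (1 + 2 * x) < a \<and> x \<in> {0<..<1}) (at_left 1)"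
    by (rule eventually_conj)
  then obtain \<alpha> :: real where \<alpha>: "1 / (2 * \<alpha>) * (1 + 2 * \<alpha>) < a" "0 < \<alpha>" "\<alpha> < 1"
    by (auto dest!: eventually_happens)
  have "(\<lambda>n. real n / (real n - 1)) \<longlonglongrightarrow> 1" by real_asymp
  then have "(\<lambda>n. (real n / (real n - 1)) / (2 * \<alpha>)
        * ((1 + 2 * \<alpha>) + (8 / (1 - \<alpha>) + 1) * (1 / harm (n - 1))) + 1 / harm (n - 1))
      \<longlonglongrightarrow> 1 / (2 * \<alpha>) * ((1 + 2 * \<alpha>) + (8 / (1 - \<alpha>) + 1) * 0) + 0"
    using \<alpha> by (intro tendsto_intros inverse_harm_tendsto_0) auto
  then have "eventually (\<lambda>n. (real n / (real n - 1)) / (2 * \<alpha>)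
        * ((1 + 2 * \<alpha>) + (8 / (1 - \<alpha>) + 1) * (1 / harm (n - 1))) + 1 / harm (n - 1) < a) sequentially"
    using \<alpha> by (intro order_tendstoD(2)) auto
  then show "eventually (\<lambda>n. gossip_ratio n < a) sequentially"
    using eventually_ge_at_top[of 2]
    by eventually_elim (use gossip_ratio_le[OF _ \<alpha>(2,3)] in fastforce)
qed

theorem theorem1p8:
  shows "(\<lambda>n. mean_time n n / mean_time n 1) \<longlonglongrightarrow> 3 / 2"
proof -
  have "(\<lambda>n. ennreal (gossip_ratio n)) \<longlonglongrightarrow> ennreal (3 / 2)"
    by (rule tendsto_ennrealI[OF gossip_ratio_tendsto])
  moreover have "ennreal (3 / 2) = 3 / 2"
    by (subst divide_ennreal[symmetric]) auto
  moreover have "eventually (\<lambda>n. ennreal (gossip_ratio n) = mean_time n n / mean_time n 1) sequentially"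
    using eventually_ge_at_top[of 2] by eventually_elim (rule mean_time_ratio[symmetric])
  ultimately show ?thesis using Lim_transform_eventually by fastforce
qed

end
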